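(* Let $K\subset L$ be a field extension having FCP. Then $\ell[K,L]=\ell[K(X),L(X)]$.
   Context: For an extension of commutative rings $R\subseteq S$, $[R,S]$ denotes the set of all $R$-subalgebras of $S$, ordered by inclusion. The extension has FCP if every chain in $[R,S]$ is finite. The length $\ell[R,S]$ is the supremum of the lengths of chains in $[R,S]$, where a chain $R_0\subset R_1\subset\cdots\subset R_n$ has length $n$. A field extension with FCP is finite. For a field $K$, $K(X)$ is the field of rational functions in the indeterminate $X$ over $K$ (which is the Nagata ring of $K$). *)

theory Defs
  imports
    "HOL-Algebra.Algebraic_Closure_Type"
    "HOL-Computational_Algebra.Fraction_Field"
    "HOL-Library.Extended_Nat"
begin

text \<open>
  A ring extension \<open>R \<subseteq> S\<close> is given by two subrings of an ambient commutative ring type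
  \<open>'a\<close>, which \<^const>\<open>ring_of_type_algebra\<close> turns into a ring with carrier \<^term>\<open>UNIV\<close>. The
  \<open>R\<close>-subalgebras of \<open>S\<close> are then the subrings \<open>T\<close> with \<open>R \<subseteq> T \<subseteq> S\<close>; in particular
  \<^const>\<open>subring\<close> makes them contain the unit of \<open>S\<close>.
\<close>

definition subalgebras_between :: "'a :: comm_ring_1 set \<Rightarrow> 'a set \<Rightarrow> 'a set set" where
  "subalgebras_between R S = {T. subring T ring_of_type_algebra \<and> R \<subseteq> T \<and> T \<subseteq> S}"

definition FCP :: "'a :: comm_ring_1 set \<Rightarrow> 'a set \<Rightarrow> bool" where
  "FCP R S \<longleftrightarrow> (\<forall>C. subset.chain (subalgebras_between R S) C \<longrightarrow> finite C)"

definition extension_length :: "'a :: comm_ring_1 set \<Rightarrow> 'a set \<Rightarrow> enat" where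
  "extension_length R S =
     Sup {enat n |n. \<exists>T :: nat \<Rightarrow> 'a set.
       (\<forall>i\<le>n. T i \<in> subalgebras_between R S) \<and> (\<forall>i<n. T i \<subset> T (Suc i))}"

text \<open>
  The field \<open>F(X)\<close> of rational functions over a subfield \<open>F\<close> of \<open>'a\<close>, realised inside the
  fraction field of \<^typ>\<open>'a poly\<close>, so that \<open>K(X) \<subseteq> L(X)\<close> for \<open>K \<subseteq> L\<close>.
\<close>

definition rational_functions :: "'a :: field set \<Rightarrow> 'a poly fract set" where
  "rational_functions F =
     {Fract p q |p q. range (coeff p) \<subseteq> F \<and> range (coeff q) \<subseteq> F \<and> q \<noteq> 0}"

lemma ring_of_type_algebra_simps [simp]:
  "carrier ring_of_type_algebra = UNIV"
  "\<one>\<^bsub>ring_of_type_algebra\<^esub> = 1"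
  "\<zero>\<^bsub>ring_of_type_algebra\<^esub> = 0"
  "x \<otimes>\<^bsub>ring_of_type_algebra\<^esub> y = x * y"
  "x \<oplus>\<^bsub>ring_of_type_algebra\<^esub> y = x + y"
  by (simp_all add: ring_of_type_algebra_def)

lemma a_inv_ring_of_type_algebra [simp]:
  "\<ominus>\<^bsub>ring_of_type_algebra\<^esub> x = - (x :: 'a :: comm_ring_1)"
proof -
  interpret cring "ring_of_type_algebra :: 'a ring"
    by (rule cring_from_type_algebra)
  show ?thesis
    using minus_equality[of "- x" x] by simp
qed

lemma subfield_rational_functions:
  fixes F :: "'a :: field set"
  assumes F: "subfield F ring_of_type_algebra"
  shows "subfield (rational_functions F) ring_of_type_algebra"
proof -
  interpret A: cring "ring_of_type_algebra :: 'a ring"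
    by (rule cring_from_type_algebra)
  interpret B: field "ring_of_type_algebra :: 'a poly fract ring"
    by (rule field_from_type_algebra)
  have sub: "subring F ring_of_type_algebra"
    by (rule subfieldE(1)[OF F])
  note [simp] = image_subset_iff
  have F0: "0 \<in> F" and F1: "1 \<in> F"
    using subringE(2,3)[OF sub] by simp_all
  have Fadd: "x + y \<in> F" and Fmult: "x * y \<in> F" if "x \<in> F" "y \<in> F" for x y
    using subringE(6,7)[OF sub that] by simp_all
  have Fneg: "- x \<in> F" if "x \<in> F" for x
    using subringE(5)[OF sub that] by simp
  have Fsum: "(\<Sum>i\<in>I. f i) \<in> F" if "\<And>i. i \<in> I \<Longrightarrow> f i \<in> F" for f :: "nat \<Rightarrow> 'a" and I
    using that by (induction I rule: infinite_finite_induct) (auto intro: F0 Fadd)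
  have pm: "\<forall>n. coeff (p * q) n \<in> F" if "\<forall>n. coeff p n \<in> F" "\<forall>n. coeff q n \<in> F" for p q
    using that by (auto simp: coeff_mult intro!: Fsum Fmult)
  have mem: "Fract p q \<in> rational_functions F"
    if "\<forall>n. coeff p n \<in> F" "\<forall>n. coeff q n \<in> F" "q \<noteq> 0" for p q
    using that by (auto simp: rational_functions_def)
  have one: "\<forall>n. coeff 1 n \<in> F"
    using F0 F1 by simp
  show ?thesis
  proof (rule B.subfieldI', rule B.subringI, unfold ring_of_type_algebra_simps a_inv_ring_of_type_algebra)
    show "rational_functions F \<subseteq> UNIV"
      by (rule subset_UNIV)
    show "1 \<in> rational_functions F"
      unfolding One_fract_def using one by (intro mem) auto
  next
    fix x assume "x \<in> rational_functions F"
    then obtain p q where x: "x = Fract p q" "q \<noteq> 0"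
      "\<forall>n. coeff p n \<in> F" "\<forall>n. coeff q n \<in> F"
      by (auto simp: rational_functions_def)
    then show "- x \<in> rational_functions F"
      by (auto intro!: mem Fneg)
  next
    fix x y assume "x \<in> rational_functions F" "y \<in> rational_functions F"
    then obtain p q r s where x: "x = Fract p q" "q \<noteq> 0"
      "\<forall>n. coeff p n \<in> F" "\<forall>n. coeff q n \<in> F"
      and y: "y = Fract r s" "s \<noteq> 0" "\<forall>n. coeff r n \<in> F" "\<forall>n. coeff s n \<in> F"
      unfolding rational_functions_def by force
    show "x * y \<in> rational_functions F"
      unfolding x y mult_fract using x y by (intro mem pm) auto
    have "\<forall>n. coeff (p * s + r * q) n \<in> F"
      using pm[OF x(3) y(4)] pm[OF y(3) x(4)] by (auto intro: Fadd)
    then show "x + y \<in> rational_functions F"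
      unfolding x(1) y(1) add_fract[OF x(2) y(2)] using x y by (intro mem pm) auto
  next
    fix x assume x': "x \<in> rational_functions F - {0}"
    then obtain p q where x: "x = Fract p q" "q \<noteq> 0"
      "\<forall>n. coeff p n \<in> F" "\<forall>n. coeff q n \<in> F"
      by (auto simp: rational_functions_def)
    with x' have "p \<noteq> 0"
      by (auto simp: fract_collapse)
    then have "x * Fract q p = 1"
      using x by (simp add: One_fract_def eq_fract)
    then have "inv\<^bsub>ring_of_type_algebra\<^esub> x = Fract q p"
      using B.comm_inv_char[of x "Fract q p"] by simp
    then show "inv\<^bsub>ring_of_type_algebra\<^esub> x \<in> rational_functions F"
      using x \<open>p \<noteq> 0\<close> by (auto intro: mem)
  qed
qed

lemma rational_functions_mono: "K \<subseteq> L \<Longrightarrow> rational_functions K \<subseteq> rational_functions L"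
  unfolding rational_functions_def by blast

lemma rational_functions_UNIV: "rational_functions (UNIV :: 'a :: field set) = UNIV"
proof -
  have "x \<in> rational_functions UNIV" for x :: "'a poly fract"
    unfolding rational_functions_def by (cases x) auto
  then show ?thesis
    by blast
qed

end

theory Submission
  imports Defs
begin

text \<open>
  The place at infinity of \<open>L(X)\<close> is unramified over \<open>K(X)\<close>. Sending an intermediate field \<open>F\<close> to
  the set of leading coefficients of its elements, which is its residue field, should therefore
  preserve degrees. Concretely, elements whose leading coefficients are independent over \<open>K\<close> are
  independent over \<open>K(X)\<close>. Hence lifts to \<open>F\<close> of a \<open>K\<close>-basis of its residue field, completed by
  constants, form a \<open>K(X)\<close>-basis of \<open>L(X)\<close>, and \<open>F\<close> cannot grow while its residue field stays
  fixed. So chains in \<open>[K(X),L(X)]\<close> map to chains in \<open>[K,L]\<close> of the same length; conversely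
  \<open>T \<mapsto> T(X)\<close> is strictly increasing because the residue field of \<open>T(X)\<close> is \<open>T\<close>.
\<close>

section \<open>Subfields of a field and finite-dimensional intermediate rings\<close>

interpretation FR: domain "ring_of_type_algebra :: 'a :: field ring"
  by (intro field.axioms(1) field_from_type_algebra)

text \<open>By uniqueness of inverses, the ring inverse of a nonzero element is
  \<open>inverse\<close>. Closure of subfields can thus be used with the type class
  operations.\<close>

lemma subfield_ring_of_type_algebra_iff:
  fixes F :: "'a :: field set"
  shows "subfield F ring_of_type_algebra \<longleftrightarrow>
    1 \<in> F \<and> (\<forall>x\<in>F. - x \<in> F) \<and> (\<forall>x\<in>F. \<forall>y\<in>F. x * y \<in> F) \<and>
    (\<forall>x\<in>F. \<forall>y\<in>F. x + y \<in> F) \<and> (\<forall>x\<in>F. x \<noteq> 0 \<longrightarrow> inverse x \<in> F)"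
    (is "?L \<longleftrightarrow> ?R")
proof -
  have inv: "inv\<^bsub>ring_of_type_algebra\<^esub> x = inverse x" if "x \<noteq> 0" for x :: 'a
    using FR.comm_inv_char[of x "inverse x"] that by simp
  show ?thesis
  proof
    assume F: ?L
    have "inverse x \<in> F" if "x \<in> F" "x \<noteq> 0" for x
      using FR.subfield_m_inv(1)[OF F, of x] inv[of x] that by simp
    then show ?R
      using subringE(3,5-7)[OF subfieldE(1)[OF F]] by simp
  next
    assume R: ?R
    show ?L
    proof (rule field.subfieldI'[OF field_from_type_algebra])
      show "subring F ring_of_type_algebra"
        using R
        by (intro FR.subringI, unfold ring_of_type_algebra_simps a_inv_ring_of_type_algebra) blast+
      show "inv\<^bsub>ring_of_type_algebra\<^esub> x \<in> F" if "x \<in> F - {\<zero>\<^bsub>ring_of_type_algebra\<^esub>}" for x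
        using R inv[of x] that by simp
    qed
  qed
qed

lemma subalgebra_of_subring:
  assumes "subring T ring_of_type_algebra" "K \<subseteq> T"
  shows "subalgebra K T ring_of_type_algebra"
  using subringE(6)[OF assms(1)] assms(2) subring.axioms(1)[OF assms(1)]
  unfolding subalgebra_def subalgebra_axioms_def by blast

text \<open>An element \<open>x\<close> of \<open>T\<close> is algebraic over \<open>K\<close>,
  because \<open>T\<close> is finite-dimensional. Hence \<open>K[x]\<close> is a field inside
  \<open>T\<close>, and it already contains the inverse of a nonzero \<open>x\<close>.\<close>

lemma subring_imp_subfield:
  fixes T :: "'a :: field set"
  assumes K: "subfield K ring_of_type_algebra" and E: "FR.finite_dimension K E"
    and T: "subring T ring_of_type_algebra" "K \<subseteq> T" "T \<subseteq> E"
  shows "subfield T ring_of_type_algebra"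
proof -
  have fin: "FR.finite_dimension K T"
    using FR.subalbegra_incl_imp_finite_dimension[OF K E subalgebra_of_subring] T by blast
  have "inverse x \<in> T" if "x \<in> T" "x \<noteq> 0" for x
  proof -
    have "(FR.algebraic over K) x"
      using FR.finite_dimension_imp_algebraic[OF K T(1) fin] that by blast
    then have "subfield (FR.simple_extension K x) ring_of_type_algebra"
      using FR.simple_extension_is_subfield[OF K] by simp
    moreover have "x \<in> FR.simple_extension K x"
      using FR.simple_extension_mem[OF subfieldE(1)[OF K]] by simp
    moreover have "FR.simple_extension K x \<subseteq> T"
      using FR.simple_extension_subring_incl[OF T(1,2)] that by blast
    ultimately show ?thesis
      using that(2) by (auto simp: subfield_ring_of_type_algebra_iff)
  qed
  then show ?thesis
    unfolding subfield_ring_of_type_algebra_iff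
    using subringE(3,5-7)[OF T(1), unfolded ring_of_type_algebra_simps a_inv_ring_of_type_algebra]
    by blast
qed

section \<open>Leading coefficient and degree of a rational function\<close>

text \<open>For nonzero \<open>x\<close> this is the residue at infinity of \<open>x\<close> divided
  by \<open>X\<close> to the degree of \<open>x\<close>. Leading coefficients are multiplicative, so
  the quotient does not depend on the fraction chosen; it is 0 for \<open>x = 0\<close>.\<close>

definition lead_fract :: "'a :: field poly fract \<Rightarrow> 'a" where
  "lead_fract x = (THE a. \<exists>p q. x = Fract p q \<and> q \<noteq> 0 \<and>
     a = Polynomial.lead_coeff p / Polynomial.lead_coeff q)"

text \<open>The value at \<open>0\<close> is unspecified.\<close>

definition degree_fract :: "'a :: field poly fract \<Rightarrow> int" where
  "degree_fract x = (THE n. \<exists>p q. x = Fract p q \<and> p \<noteq> 0 \<and> q \<noteq> 0 \<and>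
     n = int (Polynomial.degree p) - int (Polynomial.degree q))"

lemma lead_fract_Fract:
  assumes "q \<noteq> 0"
  shows "lead_fract (Fract p q) = Polynomial.lead_coeff p / Polynomial.lead_coeff q"
  unfolding lead_fract_def using assms
  by (intro the_equality) (auto simp: eq_fract frac_eq_eq simp flip: lead_coeff_mult)

lemma degree_fract_Fract:
  assumes "p \<noteq> 0" "q \<noteq> 0"
  shows "degree_fract (Fract p q) = int (Polynomial.degree p) - int (Polynomial.degree q)"
  unfolding degree_fract_def
proof (rule the_equality)
  fix n assume "\<exists>r s. Fract p q = Fract r s \<and> r \<noteq> 0 \<and> s \<noteq> 0 \<and>
    n = int (Polynomial.degree r) - int (Polynomial.degree s)"
  then obtain r s where eq: "Fract p q = Fract r s" "r \<noteq> 0" "s \<noteq> 0"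
    and n: "n = int (Polynomial.degree r) - int (Polynomial.degree s)"
    by blast
  then have "p * s = r * q"
    using assms by (simp add: eq_fract)
  then have "Polynomial.degree p + Polynomial.degree s = Polynomial.degree r + Polynomial.degree q"
    using assms eq by (metis degree_mult_eq)
  then show "n = int (Polynomial.degree p) - int (Polynomial.degree q)"
    using n by simp
qed (use assms in blast)

lemma lead_fract_eq_0_iff [simp]: "lead_fract x = 0 \<longleftrightarrow> x = 0"
  by (cases x) (auto simp: lead_fract_Fract Zero_fract_def eq_fract)

lemma lead_fract_0 [simp]: "lead_fract 0 = 0"
  by (simp only: lead_fract_eq_0_iff)

lemma lead_fract_mult: "lead_fract (x * y) = lead_fract x * lead_fract y"
  by (cases x; cases y) (auto simp: lead_fract_Fract lead_coeff_mult)

lemma lead_fract_minus: "lead_fract (- x) = - lead_fract x"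
  by (cases x) (auto simp: lead_fract_Fract)

lemma lead_fract_1 [simp]: "lead_fract 1 = 1"
  by (simp add: One_fract_def lead_fract_Fract)

lemma lead_fract_inverse: "lead_fract (inverse x) = inverse (lead_fract x)"
proof (cases "x = 0")
  case False
  then have "lead_fract x * lead_fract (inverse x) = 1"
    by (simp flip: lead_fract_mult)
  then show ?thesis
    by (metis inverse_unique)
qed simp

lemma degree_fract_mult: "x \<noteq> 0 \<Longrightarrow> y \<noteq> 0 \<Longrightarrow> degree_fract (x * y) = degree_fract x + degree_fract y"
  by (cases x rule: Fract_cases_nonzero; cases y rule: Fract_cases_nonzero)
     (auto simp: degree_fract_Fract degree_mult_eq)

text \<open>Over the common denominator \<open>q * s\<close> both numerators have the same degree.
  The coefficient of the sum there is a nonzero multiple of the sum of the leading coefficients, so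
  the degree does not drop. A zero summand is treated apart, since \<open>degree_fract 0\<close> is
  unspecified.\<close>

lemma lead_fract_add_eq:
  assumes "degree_fract x = degree_fract y" "lead_fract x + lead_fract y \<noteq> 0"
  shows "lead_fract (x + y) = lead_fract x + lead_fract y"
proof (cases "x = 0 \<or> y = 0")
  case False
  obtain p q r s where x: "x = Fract p q" "q \<noteq> 0" and y: "y = Fract r s" "s \<noteq> 0"
    by (metis Fract_cases)
  with False have [simp]: "p \<noteq> 0" "r \<noteq> 0" "q \<noteq> 0" "s \<noteq> 0"
    by (auto simp: fract_collapse)
  have d: "Polynomial.degree (p * s) = Polynomial.degree (r * q)"
    using assms(1) by (simp add: x y degree_fract_Fract degree_mult_eq)
  have c: "Polynomial.coeff (p * s + r * q) (Polynomial.degree (p * s)) =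
      (lead_fract x + lead_fract y) * (Polynomial.lead_coeff q * Polynomial.lead_coeff s)"
  proof -
    have "Polynomial.coeff (p * s + r * q) (Polynomial.degree (p * s)) =
        Polynomial.lead_coeff (p * s) + Polynomial.lead_coeff (r * q)"
      by (simp only: coeff_add d)
    then show ?thesis
      by (simp only: lead_coeff_mult) (simp add: x y lead_fract_Fract field_simps)
  qed
  with assms(2) have "Polynomial.coeff (p * s + r * q) (Polynomial.degree (p * s)) \<noteq> 0"
    by simp
  then have "Polynomial.degree (p * s + r * q) = Polynomial.degree (p * s)"
    using d degree_add_le[of "p * s" "Polynomial.degree (p * s)" "r * q"]
    by (metis le_antisym le_degree order_refl)
  then have "Polynomial.lead_coeff (p * s + r * q) =
      (lead_fract x + lead_fract y) * (Polynomial.lead_coeff q * Polynomial.lead_coeff s)"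
    using c by simp
  moreover have "x + y = Fract (p * s + r * q) (q * s)"
    by (simp add: x y)
  ultimately show ?thesis
    by (simp add: lead_fract_Fract lead_coeff_mult)
qed auto

lemma lead_fract_add_less:
  assumes "degree_fract x < degree_fract y" "x \<noteq> 0" "y \<noteq> 0"
  shows "lead_fract (x + y) = lead_fract y"
proof -
  obtain p q r s where x: "x = Fract p q" "q \<noteq> 0" and y: "y = Fract r s" "s \<noteq> 0"
    by (metis Fract_cases)
  with assms have [simp]: "p \<noteq> 0" "r \<noteq> 0" "q \<noteq> 0" "s \<noteq> 0"
    by (auto simp: fract_collapse)
  have "Polynomial.degree (p * s) < Polynomial.degree (r * q)"
    using assms(1) by (simp add: x y degree_fract_Fract degree_mult_eq)
  then have "Polynomial.lead_coeff (p * s + r * q) = Polynomial.lead_coeff (r * q)"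
    by (rule lead_coeff_add_le)
  moreover have "x + y = Fract (p * s + r * q) (q * s)"
    by (simp add: x y)
  ultimately show ?thesis
    by (simp add: y lead_fract_Fract lead_coeff_mult)
qed

section \<open>The residue field of a field of rational functions\<close>

text \<open>Powers of \<open>X\<close> and their inverses serve as \<open>t\<close>. Multiplying by
  such a \<open>t\<close> shifts degrees inside \<open>F\<close> without changing leading
  coefficients.\<close>

lemma exists_monic_of_degree_fract:
  assumes F: "subfield F ring_of_type_algebra" and X: "Fract [:0, 1:] 1 \<in> F"
  obtains t where "t \<in> F" "lead_fract t = 1" "degree_fract t = d"
proof -
  let ?X = "Fract [:0, 1:] 1 :: 'a poly fract"
  have pow: "?X ^ n \<in> F \<and> lead_fract (?X ^ n) = 1 \<and> degree_fract (?X ^ n) = int n" for n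
  proof (induction n)
    case 0
    then show ?case
      using F by (simp add: subfield_ring_of_type_algebra_iff One_fract_def degree_fract_Fract lead_fract_Fract)
  next
    case (Suc n)
    then have "?X ^ n \<noteq> 0"
      by (metis lead_fract_eq_0_iff zero_neq_one)
    moreover have "?X \<noteq> 0"
      by (auto simp: Zero_fract_def eq_fract)
    moreover have "?X * ?X ^ n \<in> F"
      using Suc F X unfolding subfield_ring_of_type_algebra_iff by blast
    moreover have "degree_fract ?X = 1" "lead_fract ?X = 1"
      by (auto simp: degree_fract_Fract lead_fract_Fract)
    ultimately show ?case
      using Suc by (simp add: degree_fract_mult lead_fract_mult del: mult_fract)
  qed
  show ?thesis
  proof (cases "d \<ge> 0")
    case True
    then show ?thesis
      using pow[of "nat d"] that by auto
  next
    case False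
    let ?Y = "?X ^ nat (- d)"
    have Y: "?Y \<in> F" "lead_fract ?Y = 1" "degree_fract ?Y = - d"
      using pow[of "nat (- d)"] False by auto
    then have nz: "?Y \<noteq> 0"
      by (metis lead_fract_eq_0_iff zero_neq_one)
    then have "inverse ?Y \<in> F"
      using Y(1) F unfolding subfield_ring_of_type_algebra_iff by blast
    moreover have "lead_fract (inverse ?Y) = 1"
      using Y(2) by (simp only: lead_fract_inverse inverse_1)
    moreover have "degree_fract (inverse ?Y * ?Y) = 0"
      using nz by (simp add: One_fract_def degree_fract_Fract)
    then have "degree_fract (inverse ?Y) = d"
      using nz Y(3) by (subst (asm) degree_fract_mult) auto
    ultimately show ?thesis
      using that by blast
  qed
qed

text \<open>Products, negatives and inverses are respected by \<open>lead_fract\<close>; only sums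
  need care. If the sum of the two leading coefficients is nonzero, multiplying \<open>y\<close> by
  a monic \<open>t\<close> in \<open>F\<close> brings it to the degree of \<open>x\<close>, and then
  the leading coefficients add up.\<close>

lemma subfield_lead_fract_image:
  assumes F: "subfield F ring_of_type_algebra" and X: "Fract [:0, 1:] 1 \<in> F"
  shows "subfield (lead_fract ` F) ring_of_type_algebra"
proof -
  have F': "1 \<in> F" "0 \<in> F" "\<And>x. x \<in> F \<Longrightarrow> - x \<in> F" "\<And>x y. x \<in> F \<Longrightarrow> y \<in> F \<Longrightarrow> x * y \<in> F"
    "\<And>x y. x \<in> F \<Longrightarrow> y \<in> F \<Longrightarrow> x + y \<in> F" "\<And>x. x \<in> F \<Longrightarrow> x \<noteq> 0 \<Longrightarrow> inverse x \<in> F"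
    using F subringE(2)[OF subfieldE(1)[OF F]]
    unfolding subfield_ring_of_type_algebra_iff ring_of_type_algebra_simps by blast+
  have "lead_fract x + lead_fract y \<in> lead_fract ` F" if "x \<in> F" "y \<in> F" for x y
  proof (cases "y = 0 \<or> lead_fract x + lead_fract y = 0")
    case True
    then show ?thesis
    proof
      assume "y = 0"
      then show ?thesis
        using that by simp
    next
      assume "lead_fract x + lead_fract y = 0"
      then show ?thesis
        using F'(2) lead_fract_0 by (metis imageI)
    qed
  next
    case False
    obtain t where t: "t \<in> F" "lead_fract t = 1" "degree_fract t = degree_fract x - degree_fract y"
      using exists_monic_of_degree_fract[OF assms] by blast
    then have "t \<noteq> 0"
      by (metis lead_fract_eq_0_iff zero_neq_one)
    then have "degree_fract x = degree_fract (t * y)"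
      using False t by (simp add: degree_fract_mult)
    then have "lead_fract (x + t * y) = lead_fract x + lead_fract y"
      using False t by (subst lead_fract_add_eq) (auto simp: lead_fract_mult)
    then show ?thesis
      using F'(4,5) t that by (metis imageI)
  qed
  moreover have "1 \<in> lead_fract ` F" "\<And>x. x \<in> F \<Longrightarrow> - lead_fract x \<in> lead_fract ` F"
    "\<And>x y. x \<in> F \<Longrightarrow> y \<in> F \<Longrightarrow> lead_fract x * lead_fract y \<in> lead_fract ` F"
    using F' by (metis imageI lead_fract_1 lead_fract_minus lead_fract_mult)+
  moreover have "inverse (lead_fract x) \<in> lead_fract ` F" if "x \<in> F" "lead_fract x \<noteq> 0" for x
    using F'(6)[of x] that by (metis imageI lead_fract_inverse lead_fract_eq_0_iff)
  ultimately show ?thesis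
    unfolding subfield_ring_of_type_algebra_iff by blast
qed

section \<open>Lifting linear independence from leading coefficients\<close>

text \<open>
  In \<open>c f + h\<close> with \<open>c f\<close> and \<open>h\<close> of equal degree the leading coefficients cannot cancel, because
  that of \<open>f\<close> is independent of the others.
\<close>

lemma lead_fract_Span:
  assumes F: "subfield F ring_of_type_algebra" and X: "Fract [:0, 1:] 1 \<in> F"
    and "FR.independent (lead_fract ` F) (map lead_fract fs)" "x \<in> FR.Span F fs"
  shows "lead_fract x \<in> FR.Span (lead_fract ` F) (map lead_fract fs)"
  using assms(3,4)
proof (induction fs arbitrary: x)
  case Nil
  then show ?case
    by simp
next
  case (Cons f fs)
  let ?k = "lead_fract ` F"
  let ?S = "FR.Span ?k (map lead_fract fs)"
  note k = subfield_lead_fract_image[OF F X]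
  have in_carrier: "set (map lead_fract fs) \<subseteq> carrier ring_of_type_algebra"
    by simp
  have S0: "0 \<in> ?S" and Sneg: "- v \<in> ?S" if "v \<in> ?S" for v
    using FR.Span_subgroup_props[OF k in_carrier] that by (simp_all del: FR.Span.simps)
  have f: "lead_fract f \<notin> ?S" and ind: "FR.independent ?k (map lead_fract fs)"
    using FR.independent_backwards(1,2)[of ?k "lead_fract f" "map lead_fract fs"] Cons.prems(1)
    by (simp_all del: FR.Span.simps)
  have "x \<in> FR.line_extension F f (FR.Span F fs)"
    using Cons.prems(2) by simp
  then obtain c h where ch: "c \<in> F" "h \<in> FR.Span F fs" and x: "x = c * f + h"
    unfolding FR.line_extension_mem_iff by auto
  have h: "lead_fract h \<in> ?S"
    using Cons.IH ind ch by blast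
  have mem: "a * lead_fract f + v \<in> FR.Span ?k (map lead_fract (f # fs))"
    if "a \<in> ?k" "v \<in> ?S" for a v
  proof -
    have "a * lead_fract f + v \<in> FR.line_extension ?k (lead_fract f) ?S"
      unfolding FR.line_extension_mem_iff ring_of_type_algebra_simps using that by blast
    then show ?thesis
      by simp
  qed
  have k0: "0 \<in> ?k"
    using subringE(2)[OF subfieldE(1)[OF k]] by simp
  have only_c: "lead_fract (c * f) \<in> FR.Span ?k (map lead_fract (f # fs))"
    using mem[OF imageI[OF ch(1)] S0[OF h]] by (simp only: lead_fract_mult add_0_right)
  have only_h: "lead_fract h \<in> FR.Span ?k (map lead_fract (f # fs))"
    using mem[OF k0 h] by (simp only: mult_zero_left add_0)
  \<comment> \<open>Zero summands are split off because their degree is unspecified. With different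
    degrees, the summand of larger degree alone supplies the leading coefficient of
    \<open>x\<close>.\<close>
  consider "c * f = 0" | "h = 0" | "c * f \<noteq> 0" "h \<noteq> 0" "degree_fract (c * f) < degree_fract h"
    | "c * f \<noteq> 0" "h \<noteq> 0" "degree_fract h < degree_fract (c * f)"
    | "c * f \<noteq> 0" "h \<noteq> 0" "degree_fract (c * f) = degree_fract h"
    by linarith
  then show ?case
  proof cases
    case 1
    then show ?thesis
      using only_h by (simp only: x add_0)
  next
    case 2
    then show ?thesis
      using only_c by (simp only: x add_0_right)
  next
    case 3
    then show ?thesis
      using only_h lead_fract_add_less[OF 3(3,1,2)] by (simp only: x)
  next
    case 4
    then show ?thesis
      using only_c lead_fract_add_less[OF 4(3,2,1)] by (simp only: x add.commute[of "c * f" h])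
  next
    case 5
    have "lead_fract (c * f) + lead_fract h \<noteq> 0"
    proof
      assume "lead_fract (c * f) + lead_fract h = 0"
      then have "lead_fract c * lead_fract f = - lead_fract h"
        by (simp add: lead_fract_mult add_eq_0_iff)
      then have "lead_fract c * lead_fract f \<in> ?S"
        using Sneg[OF h] by (simp only:)
      moreover have "lead_fract c \<noteq> 0"
        using 5(1) by auto
      ultimately have "lead_fract f \<in> ?S"
        using FR.Span_m_inv_simprule[OF k in_carrier, of "lead_fract c" "lead_fract f"] ch(1) by simp
      then show False
        using f by blast
    qed
    then have "lead_fract x = lead_fract c * lead_fract f + lead_fract h"
      using lead_fract_add_eq[OF 5(3)] unfolding x lead_fract_mult by blast
    then show ?thesis
      using mem[OF imageI[OF ch(1)] h] by (simp only:)
  qed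
qed

text \<open>If some \<open>f\<close> were in the span of its successors,
  \<open>lead_fract_Span\<close> would put its leading coefficient in the span of theirs.\<close>

lemma independent_of_independent_lead_fract:
  assumes F: "subfield F ring_of_type_algebra" and X: "Fract [:0, 1:] 1 \<in> F"
    and "FR.independent (lead_fract ` F) (map lead_fract fs)"
  shows "FR.independent F fs"
  using assms(3)
proof (induction fs)
  case (Cons f fs)
  have "lead_fract f \<notin> FR.Span (lead_fract ` F) (map lead_fract fs)"
    and ind: "FR.independent (lead_fract ` F) (map lead_fract fs)"
    using FR.independent_backwards(1,2)[of "lead_fract ` F" "lead_fract f" "map lead_fract fs"]
      Cons.prems by (simp_all del: FR.Span.simps)
  then have "f \<notin> FR.Span F fs"
    using lead_fract_Span[OF F X ind] by blast
  then show ?case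
    using Cons.IH ind by (intro FR.li_Cons) (simp_all del: FR.Span.simps)
qed auto

section \<open>Rational functions with coefficients in a subfield\<close>

lemma range_coeff_closed:
  fixes F :: "'a :: field set"
  assumes F: "subring F ring_of_type_algebra"
  shows "range (coeff 1) \<subseteq> F"
    and "range (coeff p) \<subseteq> F \<Longrightarrow> range (coeff (- p)) \<subseteq> F"
    and "range (coeff p) \<subseteq> F \<Longrightarrow> range (coeff q) \<subseteq> F \<Longrightarrow> range (coeff (p + q)) \<subseteq> F"
    and "range (coeff p) \<subseteq> F \<Longrightarrow> range (coeff q) \<subseteq> F \<Longrightarrow> range (coeff (p * q)) \<subseteq> F"
    and "a \<in> F \<Longrightarrow> range (coeff p) \<subseteq> F \<Longrightarrow> range (coeff (pCons a p)) \<subseteq> F"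
proof -
  note cl = subringE(2,3,5-7)[OF F, unfolded ring_of_type_algebra_simps a_inv_ring_of_type_algebra]
  have sum: "(\<Sum>i\<in>I. f i) \<in> F" if "\<And>i. i \<in> I \<Longrightarrow> f i \<in> F" for f :: "nat \<Rightarrow> 'a" and I
    using that by (induction I rule: infinite_finite_induct) (auto intro: cl)
  show "range (coeff 1) \<subseteq> F"
    using cl(1,2) by (auto simp: coeff_1)
  show "range (coeff (- p)) \<subseteq> F" if "range (coeff p) \<subseteq> F"
    using that cl(3) by auto
  show "range (coeff (p + q)) \<subseteq> F" if "range (coeff p) \<subseteq> F" "range (coeff q) \<subseteq> F"
    using that cl(5) by (auto simp: image_subset_iff)
  show "range (coeff (p * q)) \<subseteq> F" if "range (coeff p) \<subseteq> F" "range (coeff q) \<subseteq> F"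
    using that by (auto simp: image_subset_iff coeff_mult intro!: sum cl(4))
  show "range (coeff (pCons a p)) \<subseteq> F" if "a \<in> F" "range (coeff p) \<subseteq> F"
    using that by (auto simp: coeff_pCons image_subset_iff split: nat.splits)
qed

lemma Fract_mem_rational_functions:
  "range (coeff p) \<subseteq> F \<Longrightarrow> range (coeff q) \<subseteq> F \<Longrightarrow> q \<noteq> 0 \<Longrightarrow> Fract p q \<in> rational_functions F"
  unfolding rational_functions_def by blast

lemma
  assumes F: "subring F ring_of_type_algebra"
  shows const_mem_rational_functions: "a \<in> F \<Longrightarrow> Fract [:a:] 1 \<in> rational_functions F"
    and X_mem_rational_functions: "Fract [:0, 1:] 1 \<in> rational_functions F"
proof -
  have 0: "0 \<in> F" "1 \<in> F" "range (coeff 0) \<subseteq> F"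
    using subringE(2,3)[OF F] by auto
  show "a \<in> F \<Longrightarrow> Fract [:a:] 1 \<in> rational_functions F"
    by (intro Fract_mem_rational_functions range_coeff_closed[OF F] 0 one_neq_zero)
  show "Fract [:0, 1:] 1 \<in> rational_functions F"
    by (intro Fract_mem_rational_functions range_coeff_closed[OF F] 0 one_neq_zero)
qed

lemma lead_fract_const [simp]: "lead_fract (Fract [:a:] 1) = a"
  by (simp add: lead_fract_Fract)

text \<open>Quotients of leading coefficients stay in the field \<open>F\<close>, and constants
  attain all of \<open>F\<close>. A subfield can therefore be recovered from its field of rational
  functions.\<close>

lemma lead_fract_image_rational_functions:
  assumes F: "subfield F ring_of_type_algebra"
  shows "lead_fract ` rational_functions F = F"
proof
  note F' = F[unfolded subfield_ring_of_type_algebra_iff]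
  show "lead_fract ` rational_functions F \<subseteq> F"
  proof
    fix a assume "a \<in> lead_fract ` rational_functions F"
    then obtain p q where a: "a = Polynomial.lead_coeff p * inverse (Polynomial.lead_coeff q)"
      and pq: "range (coeff p) \<subseteq> F" "range (coeff q) \<subseteq> F" "q \<noteq> 0"
      unfolding rational_functions_def by (auto simp: lead_fract_Fract divide_inverse)
    have "Polynomial.lead_coeff p \<in> F" "Polynomial.lead_coeff q \<in> F" "Polynomial.lead_coeff q \<noteq> 0"
      using pq by auto
    then show "a \<in> F"
      using F' unfolding a by blast
  qed
  show "F \<subseteq> lead_fract ` rational_functions F"
    using const_mem_rational_functions[OF subfieldE(1)[OF F]] lead_fract_const by (metis imageI subsetI)
qed

text \<open>Embedding constants turns a \<open>K\<close>-linear combination into a combination with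
  constant coefficients in \<open>K(X)\<close>.\<close>

lemma const_mem_Span:
  assumes K: "subring K ring_of_type_algebra" and "a \<in> FR.Span K us"
  shows "Fract [:a:] 1 \<in> FR.Span (rational_functions K) (map (\<lambda>a. Fract [:a:] 1) us)"
  using assms(2)
proof (induction us arbitrary: a)
  case Nil
  then show ?case
    by (simp add: Zero_fract_def)
next
  case (Cons u us)
  then have "a \<in> FR.line_extension K u (FR.Span K us)"
    by simp
  then obtain c h where ch: "c \<in> K" "h \<in> FR.Span K us" "a = c * u + h"
    unfolding FR.line_extension_mem_iff by auto
  have "Fract [:a:] 1 = Fract [:c:] 1 * Fract [:u:] 1 + Fract [:h:] 1"
    by (simp add: ch mult.commute)
  then have "Fract [:a:] 1 \<in> FR.line_extension (rational_functions K) (Fract [:u:] 1)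
      (FR.Span (rational_functions K) (map (\<lambda>a. Fract [:a:] 1) us))"
    unfolding FR.line_extension_mem_iff ring_of_type_algebra_simps
    using const_mem_rational_functions[OF K] Cons.IH ch by blast
  then show ?case
    by simp
qed

section \<open>The degree of \<open>L(X)\<close> over \<open>K(X)\<close>\<close>

text \<open>A \<open>K\<close>-basis of \<open>L\<close>, read as constants, is a
  \<open>K(X)\<close>-basis of \<open>L(X)\<close>. It is independent because its leading
  coefficients are the original basis and \<open>K(X)\<close> has residue field \<open>K\<close>.
  Spanning is shown first for \<open>L[X]\<close>, then for fractions with denominators in
  \<open>K[X]\<close>, then for all of \<open>L(X)\<close>.\<close>

lemma dimension_rational_functions:
  assumes K: "subfield K ring_of_type_algebra" and L: "subfield L ring_of_type_algebra"
    and KL: "K \<subseteq> L" and n: "FR.dimension n K L"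
  shows "FR.dimension n (rational_functions K) (rational_functions L)"
proof -
  note K' = subfieldE(1)[OF K] and L' = subfieldE(1)[OF L]
  note KX = subfield_rational_functions[OF K]
  let ?const = "\<lambda>a. Fract [:a:] 1"
  obtain bs where bs: "FR.independent K bs" "length bs = n" "FR.Span K bs = L"
    using FR.exists_base[OF K n] by blast
  let ?bs = "map ?const bs"
  let ?S = "FR.Span (rational_functions K) ?bs"
  have "map lead_fract ?bs = bs"
    by (simp add: comp_def)
  then have ind: "FR.independent (rational_functions K) ?bs"
    using independent_of_independent_lead_fract[OF KX X_mem_rational_functions[OF K']]
      bs(1) lead_fract_image_rational_functions[OF K] by simp
  have in_carrier: "set ?bs \<subseteq> carrier ring_of_type_algebra"
    by simp
  have S0: "0 \<in> ?S" and Sadd: "\<And>x y. x \<in> ?S \<Longrightarrow> y \<in> ?S \<Longrightarrow> x + y \<in> ?S"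
    and Smult: "\<And>c x. c \<in> rational_functions K \<Longrightarrow> x \<in> ?S \<Longrightarrow> c * x \<in> ?S"
    using FR.Span_subgroup_props(2,3)[OF KX in_carrier] FR.Span_smult_closed[OF KX in_carrier]
    by (simp_all del: FR.Span.simps)
  \<comment> \<open>Splitting off the constant term writes a polynomial as \<open>a + X * p\<close>,
    where \<open>X\<close> is a scalar from \<open>K(X)\<close>.\<close>
  have poly: "Fract p 1 \<in> ?S" if "range (coeff p) \<subseteq> L" for p
    using that
  proof (induction p)
    case 0
    then show ?case
      using S0 by (simp only: Zero_fract_def)
  next
    case (pCons a p)
    have "coeff (pCons a p) 0 \<in> L" "coeff (pCons a p) (Suc i) \<in> L" for i
      using pCons.prems by blast+
    then have "a \<in> L" "range (coeff p) \<subseteq> L"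
      by auto
    then have "?const a + Fract [:0, 1:] 1 * Fract p 1 \<in> ?S"
      using const_mem_Span[OF K'] bs(3) pCons.IH
      by (intro Sadd Smult X_mem_rational_functions[OF K']) blast+
    then show ?case
      by simp
  qed
  \<comment> \<open>Being finite over \<open>K(X)\<close>, this domain is a field, so the denominators in \<open>K[X]\<close> suffice.\<close>
  define E where "E = {Fract p q |p q. range (coeff p) \<subseteq> L \<and> range (coeff q) \<subseteq> K \<and> q \<noteq> 0}"
  have E_memI: "Fract p q \<in> E"
    if "range (coeff p) \<subseteq> L" "range (coeff q) \<subseteq> K" "q \<noteq> 0" for p q
    using that unfolding E_def by blast
  have "E \<subseteq> ?S"
  proof
    fix x assume "x \<in> E"
    then obtain p q where x: "x = Fract 1 q * Fract p 1"
      and pq: "range (coeff p) \<subseteq> L" "range (coeff q) \<subseteq> K" "q \<noteq> 0"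
      unfolding E_def by auto
    show "x \<in> ?S"
      unfolding x using pq
      by (intro Smult poly Fract_mem_rational_functions range_coeff_closed(1)[OF K'])
  qed
  moreover have E_subring: "subring E ring_of_type_algebra"
  proof (rule FR.subringI, unfold ring_of_type_algebra_simps a_inv_ring_of_type_algebra)
    show "1 \<in> E"
      unfolding One_fract_def
      by (intro E_memI range_coeff_closed(1)[OF K'] range_coeff_closed(1)[OF L'] one_neq_zero)
  next
    fix x assume "x \<in> E"
    then show "- x \<in> E"
      unfolding E_def using range_coeff_closed(2)[OF L'] minus_fract by blast
  next
    fix x y assume "x \<in> E" "y \<in> E"
    then obtain p q r s where x: "x = Fract p q" and y: "y = Fract r s"
      and pq: "range (coeff p) \<subseteq> L" "range (coeff q) \<subseteq> K" "q \<noteq> 0"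
      and rs: "range (coeff r) \<subseteq> L" "range (coeff s) \<subseteq> K" "s \<noteq> 0"
      unfolding E_def by blast
    have qs: "range (coeff q) \<subseteq> L" "range (coeff s) \<subseteq> L" "q * s \<noteq> 0"
      using pq rs KL by auto
    show "x * y \<in> E"
      unfolding x y mult_fract
      by (intro E_memI range_coeff_closed(4)[OF K'] range_coeff_closed(4)[OF L'] pq rs qs)
    show "x + y \<in> E"
      unfolding x y add_fract[OF pq(3) rs(3)]
      by (intro E_memI range_coeff_closed(4)[OF K'] range_coeff_closed(3,4)[OF L'] pq rs qs)
  qed simp
  moreover have "rational_functions K \<subseteq> E"
    using KL unfolding rational_functions_def E_def by blast
  moreover have "FR.finite_dimension (rational_functions K) ?S"
    using FR.Span_finite_dimension[OF KX in_carrier] .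
  ultimately have E: "subfield E ring_of_type_algebra"
    by (intro subring_imp_subfield[OF KX]) auto
  \<comment> \<open>Numerator and denominator both lie in \<open>E\<close>, with denominator 1, so
    their quotient lies in the field \<open>E\<close>.\<close>
  have "rational_functions L \<subseteq> E"
  proof
    fix x assume "x \<in> rational_functions L"
    then obtain p q where x: "x = Fract p 1 * inverse (Fract q 1)"
      and pq: "range (coeff p) \<subseteq> L" "range (coeff q) \<subseteq> L" "q \<noteq> 0"
      unfolding rational_functions_def by auto
    have "Fract p 1 \<in> E" "Fract q 1 \<in> E" "Fract q 1 \<noteq> 0"
      using pq by (auto intro!: E_memI range_coeff_closed(1)[OF K'] simp: Zero_fract_def eq_fract)
    then show "x \<in> E"
      unfolding x using E unfolding subfield_ring_of_type_algebra_iff by blast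
  qed
  moreover have "?S \<subseteq> rational_functions L"
  proof (rule FR.subalgebra_Span_incl[OF KX subalgebra_of_subring])
    show "set ?bs \<subseteq> rational_functions L"
      using FR.Span_base_incl[OF K, of bs] bs(3) const_mem_rational_functions[OF L'] by auto
  qed (use subfield_rational_functions[OF L] rational_functions_mono[OF KL] in \<open>auto dest: subfieldE(1)\<close>)
  ultimately have "?S = rational_functions L"
    using \<open>E \<subseteq> ?S\<close> by blast
  then show ?thesis
    using FR.dimensionI[OF KX ind] bs(2) by simp
qed

section \<open>Nested intermediate fields with equal residue fields coincide\<close>

text \<open>A basis of \<open>L(X)\<close> is formed by lifts \<open>fs\<close> in \<open>F\<close>
  of a basis of the common residue field and by constants \<open>gs\<close> completing it.
  Subtracting the \<open>fs\<close>-part of an element of \<open>F'\<close> leaves a combination of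
  \<open>gs\<close> in \<open>F'\<close>. Its leading coefficient lies in the residue field, which
  forces the combination to vanish.\<close>

lemma eq_of_lead_fract_image_eq:
  assumes K: "subfield K ring_of_type_algebra" and L: "subfield L ring_of_type_algebra"
    and KL: "K \<subseteq> L" and n: "FR.dimension n K L"
    and F: "subfield F ring_of_type_algebra" "rational_functions K \<subseteq> F"
    and F': "subfield F' ring_of_type_algebra" "F \<subseteq> F'" "F' \<subseteq> rational_functions L"
    and eq: "lead_fract ` F = lead_fract ` F'"
  shows "F = F'"
proof
  note K' = subfieldE(1)[OF K]
  note KX = subfield_rational_functions[OF K]
  note lead_K = lead_fract_image_rational_functions[OF K]
    and lead_L = lead_fract_image_rational_functions[OF L]
  have X: "Fract [:0, 1:] 1 \<in> rational_functions K"
    using X_mem_rational_functions[OF K'] .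
  let ?k = "lead_fract ` F"
  have k: "subfield ?k ring_of_type_algebra"
    using subfield_lead_fract_image[OF F(1)] X F(2) by blast
  have "K \<subseteq> ?k" "?k \<subseteq> L"
    using image_mono[OF F(2), of lead_fract] image_mono[OF F'(3), of lead_fract]
    unfolding lead_K lead_L eq by simp_all
  then have "FR.finite_dimension K ?k"
    using FR.subalbegra_incl_imp_finite_dimension[OF K FR.finite_dimensionI[OF n]
        subalgebra_of_subring[OF subfieldE(1)[OF k]]] by blast
  then obtain us where us: "FR.independent K us" "FR.Span K us = ?k"
    using FR.exists_base[OF K] by (meson FR.finite_dimensionE')
  have us_k: "set us \<subseteq> ?k"
    using FR.Span_base_incl[OF K, of us] us(2) by simp
  then obtain fs where fs: "set fs \<subseteq> F" "us = map lead_fract fs"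
    using lists_image[of lead_fract F] unfolding lists_eq_set by blast
  obtain vs where vs: "length (vs @ us) = n" "FR.independent K (vs @ us)" "FR.Span K (vs @ us) = L"
    using FR.complete_base[OF K n us(1)] us_k \<open>?k \<subseteq> L\<close> by blast
  \<comment> \<open>The vectors \<open>vs\<close> that complete \<open>us\<close> need lifts in
    \<open>L(X)\<close> only, so constants suffice.\<close>
  define gs where "gs = map (\<lambda>a. Fract [:a:] 1) vs"
  have lead_gs: "map lead_fract gs = vs"
    by (simp add: gs_def comp_def)
  have "set vs \<subseteq> L"
    using FR.Span_base_incl[OF K, of "vs @ us"] vs(3) by simp
  then have "set gs \<subseteq> rational_functions L"
    using const_mem_rational_functions[OF subfieldE(1)[OF L]] by (auto simp: gs_def)
  then have "set (gs @ fs) \<subseteq> rational_functions L"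
    using fs(1) F'(2,3) by auto
  moreover have "FR.independent (rational_functions K) (gs @ fs)"
    using independent_of_independent_lead_fract[OF KX X, of "gs @ fs"] vs(2) lead_gs
    by (simp add: lead_K fs(2))
  moreover have "length (gs @ fs) = n"
    using vs(1) by (simp add: gs_def fs(2))
  \<comment> \<open>In dimension \<open>n\<close>, any \<open>n\<close> independent vectors
    span.\<close>
  ultimately have span: "FR.Span (rational_functions K) (gs @ fs) = rational_functions L"
    using FR.independent_length_eq_dimension[OF KX dimension_rational_functions[OF K L KL n]]
    by blast
  show "F' \<subseteq> F"
  proof
    fix x assume x: "x \<in> F'"
    then have "x \<in> FR.Span (rational_functions K) (gs @ fs)"
      using F'(3) span by blast
    then have "x \<in> FR.Span (rational_functions K) gs
        <+>\<^bsub>ring_of_type_algebra\<^esub> FR.Span (rational_functions K) fs"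
      using FR.Span_append_eq_set_add[OF KX, of gs fs] by (simp del: FR.Span.simps)
    then obtain a b where a: "a \<in> FR.Span (rational_functions K) gs"
      and b: "b \<in> FR.Span (rational_functions K) fs" and ab: "x = a + b"
      unfolding set_add_def' ring_of_type_algebra_simps by blast
    have "b \<in> F"
      using FR.subalgebra_Span_incl[OF KX subalgebra_of_subring[OF subfieldE(1)[OF F(1)] F(2)] fs(1)]
        b by blast
    then have "- b \<in> F'"
      using F'(1,2) unfolding subfield_ring_of_type_algebra_iff by blast
    moreover have "a = x + - b"
      by (simp add: ab)
    ultimately have "a \<in> F'"
      using x F'(1) unfolding subfield_ring_of_type_algebra_iff by blast
    \<comment> \<open>The leading coefficient of \<open>a\<close> lies in the span of
      \<open>us\<close> because \<open>a\<close> is in \<open>F'\<close>, and in the span of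
      \<open>vs\<close> because \<open>a\<close> is a combination of \<open>gs\<close>. By
      independence of \<open>vs @ us\<close> these spans meet only in 0.\<close>
    then have "lead_fract a \<in> FR.Span K us"
      using us(2) eq by blast
    moreover have "lead_fract a \<in> FR.Span K vs"
      using lead_fract_Span[OF KX X, of gs a] a FR.independent_split(2)[OF K vs(2)] lead_gs
      by (simp only: lead_K)
    ultimately have "lead_fract a = 0"
      using FR.independent_split(3)[OF K vs(2)] unfolding ring_of_type_algebra_simps by blast
    then show "x \<in> F"
      using \<open>b \<in> F\<close> by (simp add: ab)
  qed
qed (rule F'(2))

section \<open>FCP forces finite degree\<close>

text \<open>HOL-Algebra represents a polynomial by its coefficient list with the leading coefficient
  first, hence the reversal of \<open>coeffs p\<close>. Both evaluations follow the same Horner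
  recursion.\<close>

lemma algebraic_of_poly_root:
  fixes K :: "'a :: field set"
  assumes K: "subring K ring_of_type_algebra"
    and p: "range (coeff p) \<subseteq> K" "p \<noteq> 0" "poly p x = 0"
  shows "(FR.algebraic over K) x"
proof (rule FR.algebraicI)
  have eval: "FR.eval (rev cs) x = poly (Poly cs) x" for cs
  proof (induction cs)
    case (Cons c cs)
    have "FR.eval (rev cs @ [c]) x = FR.eval (rev cs) x * x + c"
      using FR.eval_append_aux[of "rev cs" c x] by simp
    then show ?case
      using Cons.IH by simp
  qed simp
  then show "FR.eval (rev (coeffs p)) x = \<zero>\<^bsub>ring_of_type_algebra\<^esub>"
    using p(3) by simp
  have "hd (rev (coeffs p)) = Polynomial.lead_coeff p"
    using p(2) by (simp add: hd_rev last_coeffs_eq_coeff_degree)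
  moreover have "set (coeffs p) \<subseteq> K"
    using p(1) by (auto simp: coeffs_def)
  ultimately show "rev (coeffs p) \<in> carrier (K[X]\<^bsub>ring_of_type_algebra\<^esub>)"
    using p(2) by (simp add: polynomial_def flip: univ_poly_carrier)
  show "rev (coeffs p) \<noteq> []"
    using p(2) by simp
qed

lemma simple_extension_poly:
  fixes K :: "'a :: field set"
  assumes K: "subring K ring_of_type_algebra" and "y \<in> FR.simple_extension K x"
  obtains p where "range (coeff p) \<subseteq> K" "y = poly p x"
proof -
  have "\<exists>p. range (coeff p) \<subseteq> K \<and> y = poly p x"
    using assms(2)
  proof (induction rule: FR.simple_extension.induct)
    case zero
    then show ?case
      using subringE(2)[OF K] by (intro exI[of _ 0]) auto
  next
    case (lin k1 k2)
    then obtain p where p: "range (coeff p) \<subseteq> K" "k1 = poly p x"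
      \<comment> \<open>The generating rule \<open>k1 * x + k2\<close> of the simple extension is a
        Horner step, so \<open>pCons\<close> gives the next polynomial.\<close>
      by blast
    then show ?case
      using range_coeff_closed(5)[OF K lin.hyps(2)] by (intro exI[of _ "pCons k2 p"]) auto
  qed
  then show ?thesis
    using that by blast
qed

text \<open>The rings \<open>K[x]\<close>, \<open>K[x^2]\<close>, \<open>K[x^4]\<close>, ...
  decrease, since each generator is the square of the previous one. By FCP two of them coincide,
  which expresses some power \<open>x^d\<close> as a polynomial in \<open>x^(2*d)\<close> and so
  gives an algebraic relation.\<close>

lemma FCP_imp_algebraic:
  assumes K: "subfield K ring_of_type_algebra" and L: "subfield L ring_of_type_algebra"
    and KL: "K \<subseteq> L" and FCP: "FCP K L" and x: "x \<in> L"
  shows "(FR.algebraic over K) x"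
proof -
  note K' = subfieldE(1)[OF K] and L' = subfieldE(1)[OF L]
  define R where "R n = FR.simple_extension K (x ^ (2 ^ n))" for n :: nat
  have R_subring: "subring (R n) ring_of_type_algebra" and K_R: "K \<subseteq> R n"
    and mem_R: "x ^ (2 ^ n) \<in> R n" for n
    unfolding R_def using FR.simple_extension_is_subring[OF K'] FR.simple_extension_incl
      FR.simple_extension_mem[OF K'] by simp_all
  have mult: "a * b \<in> T" if "subring T ring_of_type_algebra" "a \<in> T" "b \<in> T" for a b :: 'a and T
    using subringE(6)[OF that] by simp
  have pow: "x ^ n \<in> L" for n
    using subringE(3)[OF L'] x mult[OF L'] by (induction n) auto
  have R_L: "R n \<subseteq> L" for n
    unfolding R_def using FR.simple_extension_subring_incl[OF L' KL pow] .
  have square: "x ^ (2 ^ Suc n) = x ^ (2 ^ n) * x ^ (2 ^ n)" for n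
    by (simp add: mult_2 power_add)
  have "R (Suc n) \<subseteq> R n" for n
    unfolding R_def[of "Suc n"]
    by (rule FR.simple_extension_subring_incl[OF R_subring K_R])
       (unfold square, intro mult[OF R_subring] mem_R)
  then have anti: "R m \<subseteq> R n" if "n \<le> m" for n m
    using that lift_Suc_antimono_le[of R] by blast
  have "R m \<subseteq> R n \<or> R n \<subseteq> R m" for m n
    using anti nat_le_linear by blast
  moreover have "range R \<subseteq> subalgebras_between K L"
    unfolding subalgebras_between_def using R_subring K_R R_L by blast
  ultimately have "subset.chain (subalgebras_between K L) (range R)"
    unfolding subset_chain_def by blast
  then have "finite (range R)"
    using FCP unfolding FCP_def by blast
  then obtain m n where "m < n" "R m = R n"
    by (metis finite_imageD infinite_UNIV_nat injI linorder_neqE_nat)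
  \<comment> \<open>The ring \<open>R (Suc m)\<close> lies between \<open>R n\<close> and
    \<open>R m\<close>, which are equal.\<close>
  then have "x ^ (2 ^ m) \<in> R (Suc m)"
    using anti[of "Suc m" n] mem_R[of m] by auto
  then obtain p where p: "range (coeff p) \<subseteq> K" "x ^ (2 ^ m) = poly p (x ^ (2 ^ Suc m))"
    unfolding R_def using simple_extension_poly[OF K'] by blast
  \<comment> \<open>Nonzero, since the degree of \<open>p(X\<^bsup>2d\<^esup>)\<close> is a multiple of \<open>2d\<close> and that of \<open>X\<^bsup>d\<^esup>\<close> is not.\<close>
  define q where "q = pcompose p (Polynomial.monom 1 (2 ^ Suc m)) - Polynomial.monom 1 (2 ^ m)"
  have 01: "0 \<in> K" "1 \<in> K"
    using subringE(2,3)[OF K'] by simp_all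
  have monom: "range (coeff (Polynomial.monom 1 k)) \<subseteq> K" for k
    using 01 by auto
  have "range (coeff (pcompose r (Polynomial.monom 1 k))) \<subseteq> K" if "range (coeff r) \<subseteq> K" for r k
    using that
  proof (induction r)
    case 0
    then show ?case
      by simp
  next
    case (pCons a r)
    have "coeff (pCons a r) 0 \<in> K" "coeff (pCons a r) (Suc i) \<in> K" for i
      using pCons.prems by blast+
    then have "a \<in> K" "range (coeff r) \<subseteq> K"
      by auto
    moreover have "range (coeff 0) \<subseteq> K"
      using 01 by auto
    ultimately show ?case
      unfolding pcompose_pCons by (intro range_coeff_closed[OF K'] pCons.IH monom)
  qed
  then have "range (coeff q) \<subseteq> K"
    unfolding q_def diff_conv_add_uminus using p(1)
    by (intro range_coeff_closed(2,3)[OF K'] monom) blast+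
  moreover have "q \<noteq> 0"
  proof
    assume "q = 0"
    then have "Polynomial.degree (pcompose p (Polynomial.monom 1 (2 ^ Suc m))) =
        Polynomial.degree (Polynomial.monom (1 :: 'a) (2 ^ m))"
      by (simp add: q_def)
    then show False
      by (simp add: degree_pcompose degree_monom_eq)
  qed
  moreover have "poly q x = 0"
    using p(2) by (simp add: q_def poly_pcompose poly_monom)
  ultimately show ?thesis
    by (rule algebraic_of_poly_root[OF K'])
qed

text \<open>Zorn yields a maximal finite-dimensional intermediate ring \<open>M\<close>: by FCP a
  nonempty chain is finite and contains its union, and \<open>K\<close> bounds the empty chain. For
  \<open>x\<close> in \<open>L\<close>, algebraic over \<open>M\<close>, the tower law makes
  \<open>M[x]\<close> finite over \<open>K\<close>, so maximality puts \<open>x\<close> in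
  \<open>M\<close>.\<close>

lemma FCP_imp_finite_dimension:
  assumes K: "subfield K ring_of_type_algebra" and L: "subfield L ring_of_type_algebra"
    and KL: "K \<subseteq> L" and FCP: "FCP K L"
  shows "FR.finite_dimension K L"
proof -
  define A where "A = {T \<in> subalgebras_between K L. FR.finite_dimension K T}"
  have "K \<in> A"
    using subfieldE(1)[OF K] KL FR.finite_dimensionI[OF FR.dimension_one[OF K]]
    by (auto simp: A_def subalgebras_between_def)
  have "\<exists>M\<in>A. \<forall>T\<in>A. M \<subseteq> T \<longrightarrow> T = M"
  proof (rule subset_Zorn)
    fix C assume C: "subset.chain A C"
    then have "subset.chain (subalgebras_between K L) C"
      unfolding subset_chain_def A_def by blast
    then have "finite C"
      using FCP unfolding FCP_def by blast
    show "\<exists>U\<in>A. \<forall>T\<in>C. T \<subseteq> U"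
    proof (cases "C = {}")
      case False
      then have "\<Union>C \<in> C"
        using Union_in_chain[OF \<open>finite C\<close> _ C] by blast
      moreover have "C \<subseteq> A"
        using C by (simp add: subset_chain_def)
      ultimately show ?thesis
        by (metis Union_upper subsetD)
    qed (use \<open>K \<in> A\<close> in blast)
  qed
  then obtain M where M: "M \<in> A" and max: "\<forall>T\<in>A. M \<subseteq> T \<longrightarrow> T = M"
    by blast
  from M have M': "subring M ring_of_type_algebra" "K \<subseteq> M" "M \<subseteq> L" "FR.finite_dimension K M"
    unfolding A_def subalgebras_between_def by blast+
  then have M_subfield: "subfield M ring_of_type_algebra"
    using subring_imp_subfield[OF K M'(4)] by blast
  have "x \<in> M" if x: "x \<in> L" for x
  proof -
    let ?T = "FR.simple_extension M x"
    have "(FR.algebraic over M) x"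
      using FR.algebraic_mono[OF M'(2)] FCP_imp_algebraic[OF K L KL FCP x] .
    then have "FR.finite_dimension M ?T"
      using FR.finite_dimension_simple_extension[OF M_subfield] by simp
    then have "FR.finite_dimension K ?T"
      using FR.telescopic_base_dim(1)[OF K M_subfield M'(4)] by blast
    moreover have "subring ?T ring_of_type_algebra" "M \<subseteq> ?T" "?T \<subseteq> L" "x \<in> ?T"
      using FR.simple_extension_is_subring[OF M'(1)] FR.simple_extension_incl[of M x]
        FR.simple_extension_subring_incl[OF subfieldE(1)[OF L] M'(3) x]
        FR.simple_extension_mem[OF M'(1)] by simp_all
    ultimately have "?T = M"
      using M'(2) by (intro max[rule_format]) (unfold A_def subalgebras_between_def, blast+)
    then show ?thesis
      using \<open>x \<in> ?T\<close> by simp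
  qed
  then show ?thesis
    using M'(3,4) subset_antisym[of M L] by blast
qed

section \<open>Transferring chains between \<open>[K,L]\<close> and
  \<open>[K(X),L(X)]\<close>\<close>

theorem theorem2p5:
  fixes K L :: "'a :: field set"
  assumes "subfield K ring_of_type_algebra"
    and "subfield L ring_of_type_algebra"
    and "K \<subset> L"
    and "FCP K L"
  shows "extension_length K L =
         extension_length (rational_functions K) (rational_functions L)"
proof -
  note K = assms(1) and L = assms(2)
  note KX = subfield_rational_functions[OF K]
  have KL: "K \<subseteq> L"
    using assms(3) by blast
  obtain n where n: "FR.dimension n K L"
    using FCP_imp_finite_dimension[OF K L KL assms(4)] by blast
  note fin = FR.finite_dimensionI[OF n]
    and finX = FR.finite_dimensionI[OF dimension_rational_functions[OF K L KL n]]
  have up: "rational_functions T \<in> subalgebras_between (rational_functions K) (rational_functions L)"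
    and up_strict: "T' \<in> subalgebras_between K L \<Longrightarrow> T \<subset> T' \<Longrightarrow>
      rational_functions T \<subset> rational_functions T'"
    if T: "T \<in> subalgebras_between K L" for T T'
  proof -
    \<comment> \<open>Finite dimension makes every intermediate ring a field, so the results on
      subfields apply to all members of a chain.\<close>
    have subfield: "subfield S ring_of_type_algebra" if "S \<in> subalgebras_between K L" for S
      using that subring_imp_subfield[OF K fin] unfolding subalgebras_between_def by blast
    show "rational_functions T \<in> subalgebras_between (rational_functions K) (rational_functions L)"
      using subfieldE(1)[OF subfield_rational_functions[OF subfield[OF T]]] T rational_functions_mono
      unfolding subalgebras_between_def by blast
    show "rational_functions T \<subset> rational_functions T'"
      if "T' \<in> subalgebras_between K L" "T \<subset> T'"
      using that(2) rational_functions_mono[of T T']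
        lead_fract_image_rational_functions[OF subfield[OF T]]
        lead_fract_image_rational_functions[OF subfield[OF that(1)]]
      by (metis psubset_eq)
  qed
  have down: "lead_fract ` F \<in> subalgebras_between K L"
    and down_strict: "F' \<in> subalgebras_between (rational_functions K) (rational_functions L) \<Longrightarrow>
      F \<subset> F' \<Longrightarrow> lead_fract ` F \<subset> lead_fract ` F'"
    if F: "F \<in> subalgebras_between (rational_functions K) (rational_functions L)" for F F'
  proof -
    have subfield: "subfield S ring_of_type_algebra" "rational_functions K \<subseteq> S" "S \<subseteq> rational_functions L"
      if "S \<in> subalgebras_between (rational_functions K) (rational_functions L)" for S
      using that subring_imp_subfield[OF KX finX] unfolding subalgebras_between_def by blast+
    \<comment> \<open>Containing \<open>X\<close> is what makes the set of leading coefficients of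
      \<open>F\<close> a field.\<close>
    have "Fract [:0, 1:] 1 \<in> F"
      using X_mem_rational_functions[OF subfieldE(1)[OF K]] subfield(2)[OF F] by blast
    then show "lead_fract ` F \<in> subalgebras_between K L"
      using subfieldE(1)[OF subfield_lead_fract_image[OF subfield(1)[OF F]]]
        image_mono[OF subfield(2)[OF F], of lead_fract] image_mono[OF subfield(3)[OF F], of lead_fract]
      unfolding subalgebras_between_def
        lead_fract_image_rational_functions[OF K] lead_fract_image_rational_functions[OF L]
      by blast
    show "lead_fract ` F \<subset> lead_fract ` F'"
      if "F' \<in> subalgebras_between (rational_functions K) (rational_functions L)" "F \<subset> F'"
      using eq_of_lead_fract_image_eq[OF K L KL n subfield(1,2)[OF F] subfield(1)[OF that(1)] _
          subfield(3)[OF that(1)]] that(2) image_mono[of F F' lead_fract]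
      by blast
  qed
  \<comment> \<open>Both extensions admit chains of exactly the same lengths \<open>m\<close>, so
    the two suprema range over the same set.\<close>
  have "(\<exists>T. (\<forall>i\<le>m. T i \<in> subalgebras_between K L) \<and> (\<forall>i<m. T i \<subset> T (Suc i))) \<longleftrightarrow>
    (\<exists>T. (\<forall>i\<le>m. T i \<in> subalgebras_between (rational_functions K) (rational_functions L)) \<and>
      (\<forall>i<m. T i \<subset> T (Suc i)))" for m
  proof (safe, goal_cases)
    case (1 T)
    then show ?case
      using up up_strict by (intro exI[of _ "\<lambda>i. rational_functions (T i)"]) (simp add: Suc_leI)
  next
    case (2 T)
    then show ?case
      using down down_strict by (intro exI[of _ "\<lambda>i. lead_fract ` T i"]) (simp add: Suc_leI)
  qed
  then show ?thesis
    unfolding extension_length_def by simp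
qed

end
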